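(* Let $n\ge 2$ and let $A$ be an $n\times n$ real matrix satisfying $A+A^{\top}=\alpha\,ww^{\top}$ for some $\alpha\in\mathbb{R}$ and some $w\in\mathbb{R}^n\setminus\{0\}$. Then $$\sqrt{\det A_{n-1}(1,1)\,\det A_{n-1}(2,2)}=\left|\frac{\det A_{n-1}(1,2)+\det A_{n-1}(2,1)}{2}\right|,$$ where it is part of the assertion that the product under the square root is nonnegative.
   Context: For an $n\times n$ matrix $A=(a_{pq})$, integers $1\le r\le n$ and $1\le i,j\le n-r+1$, $A_r(i,j):=(a_{pq})_{i\le p\le i+r-1,\ j\le q\le j+r-1}$ denotes the $r\times r$ contiguous submatrix of $A$ consisting of rows $i,\dots,i+r-1$ and columns $j,\dots,j+r-1$. *)

theory Defs
  imports Complex_Main "Jordan_Normal_Form.Determinant" "Jordan_Normal_Form.DL_Submatrix"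
begin

(* \<open>contig_submat A r i j\<close> is $A_r(i,j)$. As in the mathematical notation, i and j count from 1,
   whereas the rows and columns of the type mat count from 0; hence the shift. It is the intended
   matrix for 1 \<le> i, j \<le> n - r + 1, where n is the dimension of A. *)
definition contig_submat :: "'a mat \<Rightarrow> nat \<Rightarrow> nat \<Rightarrow> nat \<Rightarrow> 'a mat" where
  "contig_submat A r i j = submatrix A {i - 1..<i - 1 + r} {j - 1..<j - 1 + r}"

lemma pick_atLeastLessThan:
  assumes "k < r"
  shows "pick {a..<a + r} k = a + k"
proof -
  have "a + k \<in> {a..<a + r}" using assms by simp
  moreover have "{x \<in> {a..<a + r}. x < a + k} = {a..<a + k}" using assms by auto
  ultimately show ?thesis
    using pick_card_in_set[of "a + k" "{a..<a + r}"] by simp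
qed

lemma contig_submat_eq:
  assumes A: "A \<in> carrier_mat n n"
    and i: "1 \<le> i" "i + r \<le> n + 1" and j: "1 \<le> j" "j + r \<le> n + 1"
  shows "contig_submat A r i j = mat r r (\<lambda>(p, q). A $$ (i - 1 + p, j - 1 + q))"
proof -
  have card: "card {x. x < n \<and> x \<in> {a - 1..<a - 1 + r}} = r" if "1 \<le> a" "a + r \<le> n + 1" for a
  proof -
    have "{x. x < n \<and> x \<in> {a - 1..<a - 1 + r}} = {a - 1..<a - 1 + r}" using that by auto
    then show ?thesis by simp
  qed
  have dims: "dim_row A = n" "dim_col A = n" using A by auto
  show ?thesis
    unfolding contig_submat_def submatrix_def dims card[OF i] card[OF j]
    by (rule eq_matI) (auto simp: pick_atLeastLessThan)
qed

end

(* Write C for the adjugate of A. Multiplying the hypothesis by C on the left and by its transpose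
   on the right gives det A * (C + C^T) = alpha * v v^T with v = C w, which settles the invertible
   case: the (1,1), (n,n) and (1,n) entries of C + C^T are proportional to v_1^2, v_n^2 and v_1 v_n.
   If det A = 0, then any x in the kernel of A satisfies
   0 = x^T (A + A^T) x = alpha * (w . x)^2, so that A^T x = alpha * (w . x) w - A x = 0. Thus the
   rows and the columns of C all lie in the kernel of A, and any two vectors of this kernel are
   proportional as soon as C is nonzero; this makes C symmetric of rank at most one. *)

theory Submission
  imports Defs
begin

text \<open>Laplace expansion along column \<open>j\<close>: deleting that column removes the only
  change to \<open>A\<close>, so the cofactors are those of \<open>A\<close>, and the unit vector
  keeps just one of them. Adjugate entries thus become determinants, which a nonzero kernel vector
  forces to vanish.\<close>

lemma det_replace_col_unit_vec:
  fixes A :: "'a::comm_ring_1 mat"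
  assumes A: "A \<in> carrier_mat n n" and j: "j < n" and p: "p < n"
  shows "det (replace_col A (unit_vec n p) j) = adj_mat A $$ (j, p)"
proof -
  let ?B = "replace_col A (unit_vec n p) j"
  have B: "?B \<in> carrier_mat n n" using A by (auto simp: replace_col_def)
  have "mat_delete ?B i j = mat_delete A i j" if "i < n" for i
    using A j that by (auto intro!: eq_matI simp: replace_col_def mat_delete_def)
  then have "cofactor ?B i j = cofactor A i j" if "i < n" for i
    using that by (simp add: cofactor_def)
  then have "det ?B = (\<Sum>i<n. if i = p then cofactor A i j else 0)"
    unfolding laplace_expansion_column[OF B j]
    by (intro sum.cong) (use A j p in \<open>auto simp: replace_col_def\<close>)
  also have "\<dots> = adj_mat A $$ (j, p)"
    using A j p by (simp add: adj_mat_def)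
  finally show ?thesis .
qed

text \<open>A rank-free form of the fact that a nonzero adjugate leaves a kernel of dimension at
  most one: two kernel vectors are proportional, expressed through their 2x2 minors.\<close>

lemma adj_mat_kernel_minors:
  fixes A :: "'a::field mat"
  assumes A: "A \<in> carrier_mat n n" and x: "x \<in> carrier_vec n" and y: "y \<in> carrier_vec n"
    and Ax: "A *\<^sub>v x = 0\<^sub>v n" and Ay: "A *\<^sub>v y = 0\<^sub>v n"
    and j: "j < n" and p: "p < n" and k: "k < n"
  shows "adj_mat A $$ (j, p) * (y $ j * x $ k - x $ j * y $ k) = 0"
proof (rule ccontr)
  \<comment> \<open>The combination of \<open>x\<close> and \<open>y\<close> whose entry
    \<open>j\<close> cancels. Column \<open>j\<close> is therefore multiplied by zero, and replacing
    it does not affect the product with \<open>z\<close>.\<close>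
  define z where "z = y $ j \<cdot>\<^sub>v x - x $ j \<cdot>\<^sub>v y"
  let ?B = "replace_col A (unit_vec n p) j"
  have B: "?B \<in> carrier_mat n n" using A by (auto simp: replace_col_def)
  assume nz: "\<not> ?thesis"
  have z: "z \<in> carrier_vec n" using x y by (simp add: z_def)
  have "z $ k \<noteq> 0" using nz x y k by (auto simp: z_def)
  then have "z \<noteq> 0\<^sub>v n" using k by auto
  have zj: "z $ j = 0" using x y j by (simp add: z_def)
  have "A *\<^sub>v z = y $ j \<cdot>\<^sub>v (A *\<^sub>v x) - x $ j \<cdot>\<^sub>v (A *\<^sub>v y)"
    using A x y by (simp add: z_def mult_minus_distrib_mat_vec mult_mat_vec)
  then have Az: "A *\<^sub>v z = 0\<^sub>v n" by (auto simp: Ax Ay)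
  have "?B *\<^sub>v z = A *\<^sub>v z"
    using A z zj by (auto intro!: eq_vecI sum.cong simp: replace_col_def scalar_prod_def)
  then have "det ?B = 0"
    using det_0_iff_vec_prod_zero_field[OF B] z \<open>z \<noteq> 0\<^sub>v n\<close> Az by auto
  then show False
    using nz det_replace_col_unit_vec[OF A j p] by auto
qed

lemma mat_plus_transpose_rank_one_entries:
  fixes A :: "'a::comm_semiring_1 mat"
  assumes A: "A \<in> carrier_mat n n" and w: "w \<in> carrier_vec n"
    and eq: "A + A\<^sup>T = \<alpha> \<cdot>\<^sub>m (mat_of_cols n [w] * (mat_of_cols n [w])\<^sup>T)"
    and p: "p < n" and q: "q < n"
  shows "A $$ (p, q) + A $$ (q, p) = \<alpha> * (w $ p * w $ q)"
proof -
  have "(A + A\<^sup>T) $$ (p, q) = (\<alpha> \<cdot>\<^sub>m (mat_of_cols n [w] * (mat_of_cols n [w])\<^sup>T)) $$ (p, q)"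
    by (simp only: eq)
  then show ?thesis
    using A w p q by (simp add: scalar_prod_def mat_of_cols_index)
qed

lemma kernel_transpose:
  fixes A :: "'a::field mat"
  assumes A: "A \<in> carrier_mat n n" and w: "w \<in> carrier_vec n"
    and sym: "\<And>p q. p < n \<Longrightarrow> q < n \<Longrightarrow> A $$ (p, q) + A $$ (q, p) = \<alpha> * (w $ p * w $ q)"
    and x: "x \<in> carrier_vec n" and Ax: "A *\<^sub>v x = 0\<^sub>v n"
  shows "A\<^sup>T *\<^sub>v x = 0\<^sub>v n"
proof -
  have T: "A\<^sup>T *\<^sub>v x = (\<alpha> * (w \<bullet> x)) \<cdot>\<^sub>v w"
  proof (rule eq_vecI)
    fix p assume "p < dim_vec ((\<alpha> * (w \<bullet> x)) \<cdot>\<^sub>v w)"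
    then have p: "p < n" using w by simp
    have "(A\<^sup>T *\<^sub>v x) $ p + (A *\<^sub>v x) $ p
      = (\<Sum>q\<in>{0..<n}. (A $$ (p, q) + A $$ (q, p)) * x $ q)"
      using A x p by (simp add: scalar_prod_def sum.distrib[symmetric] algebra_simps)
    also have "\<dots> = (\<Sum>q\<in>{0..<n}. \<alpha> * w $ p * (w $ q * x $ q))"
      by (intro sum.cong) (use p in \<open>auto simp: sym\<close>)
    also have "\<dots> = ((\<alpha> * (w \<bullet> x)) \<cdot>\<^sub>v w) $ p"
      using w x p by (simp add: scalar_prod_def sum_distrib_left[symmetric])
    finally show "(A\<^sup>T *\<^sub>v x) $ p = ((\<alpha> * (w \<bullet> x)) \<cdot>\<^sub>v w) $ p"
      using p by (simp add: Ax)
  qed (use A w in auto)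
  \<comment> \<open>Pairing \<open>T\<close> with \<open>x\<close> gives \<alpha> (w . x)^2 on one
    side and x . (A x) = 0 on the other.\<close>
  have "(A\<^sup>T *\<^sub>v x) \<bullet> x = x \<bullet> (A *\<^sub>v x)"
    by (rule transpose_vec_mult_scalar[OF A x x])
  then have "\<alpha> * (w \<bullet> x) * (w \<bullet> x) = 0"
    using w x by (simp add: T Ax)
  then have "\<alpha> * (w \<bullet> x) = 0" by auto
  then show ?thesis using w by (auto simp: T)
qed

lemma col_adj_mat_in_kernel:
  fixes A :: "'a::comm_ring_1 mat"
  assumes A: "A \<in> carrier_mat n n" and "det A = 0" and i: "i < n"
  shows "A *\<^sub>v col (adj_mat A) i = 0\<^sub>v n"
proof -
  have "A *\<^sub>v col (adj_mat A) i = col (A * adj_mat A) i"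
    using A adj_mat(1)[OF A] i by simp
  then show ?thesis
    using assms adj_mat(2)[OF A] by auto
qed

lemma row_adj_mat_in_kernel_transpose:
  fixes A :: "'a::comm_ring_1 mat"
  assumes A: "A \<in> carrier_mat n n" and "det A = 0" and i: "i < n"
  shows "A\<^sup>T *\<^sub>v row (adj_mat A) i = 0\<^sub>v n"
proof -
  have C: "adj_mat A \<in> carrier_mat n n" by (rule adj_mat(1)[OF A])
  have "A\<^sup>T * (adj_mat A)\<^sup>T = (adj_mat A * A)\<^sup>T"
    using transpose_mult[OF C A] by simp
  then have "col (A\<^sup>T * (adj_mat A)\<^sup>T) i = 0\<^sub>v n"
    using assms adj_mat(3)[OF A] by auto
  moreover have "col (A\<^sup>T * (adj_mat A)\<^sup>T) i = A\<^sup>T *\<^sub>v row (adj_mat A) i"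
    using A C i by simp
  ultimately show ?thesis by simp
qed

lemma adj_mat_entries_singular:
  fixes A :: "'a::field mat"
  assumes A: "A \<in> carrier_mat n n" and w: "w \<in> carrier_vec n"
    and sym: "\<And>p q. p < n \<Longrightarrow> q < n \<Longrightarrow> A $$ (p, q) + A $$ (q, p) = \<alpha> * (w $ p * w $ q)"
    and det: "det A = 0" and i: "i < n" and j: "j < n"
  shows "adj_mat A $$ (i, j) = adj_mat A $$ (j, i)"
    and "adj_mat A $$ (i, i) * adj_mat A $$ (j, j) = adj_mat A $$ (i, j) * adj_mat A $$ (j, i)"
proof -
  define C where "C = adj_mat A"
  have C: "C \<in> carrier_mat n n" unfolding C_def by (rule adj_mat(1)[OF A])
  have symT: "A\<^sup>T $$ (p, q) + A\<^sup>T $$ (q, p) = \<alpha> * (w $ p * w $ q)" if "p < n" "q < n" for p q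
    using sym[OF that] A that by (simp add: add.commute)
  have col: "A *\<^sub>v col C k = 0\<^sub>v n" if "k < n" for k
    unfolding C_def by (rule col_adj_mat_in_kernel[OF A det that])
  \<comment> \<open>The rows of C lie in the kernel of A^T. The hypothesis is invariant under
    transposition, so \<open>kernel_transpose\<close> applied to A^T moves them into the kernel of
    A.\<close>
  have row: "A *\<^sub>v row C k = 0\<^sub>v n" if "k < n" for k
    using kernel_transpose[of "A\<^sup>T" n w \<alpha> "row C k"] symT
      row_adj_mat_in_kernel_transpose[OF A det that] A C w that
    by (auto simp: C_def)
  have cc: "C $$ (b, a) * (C $$ (b, b) * C $$ (a, a) - C $$ (b, a) * C $$ (a, b)) = 0"
    and ccd: "C $$ (b, b) * (C $$ (b, b) * C $$ (a, a) - C $$ (b, a) * C $$ (a, b)) = 0"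
    and cr: "C $$ (b, a) * (C $$ (b, b) * C $$ (a, a) - C $$ (b, a) * C $$ (b, a)) = 0"
    if "a < n" "b < n" for a b
    using adj_mat_kernel_minors[OF A _ _ col[of a] col[of b], of b a a]
      adj_mat_kernel_minors[OF A _ _ col[of a] col[of b], of b b a]
      adj_mat_kernel_minors[OF A _ _ col[of a] row[of b], of b a a] C that
    by (auto simp: C_def[symmetric])
  \<comment> \<open>If C_ji is nonzero, \<open>cc\<close> and \<open>cr\<close> give C_ji C_ij =
    C_jj C_ii = C_ji^2, and C_ji cancels. The same works with i and j exchanged; otherwise both
    entries are zero.\<close>
  show eq: "adj_mat A $$ (i, j) = adj_mat A $$ (j, i)"
    using cc[OF i j] cr[OF i j] cc[OF j i] cr[OF j i]
    unfolding C_def[symmetric] by auto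
  \<comment> \<open>For C_jj nonzero, cancel it in \<open>ccd\<close>. For C_jj = 0,
    \<open>cc\<close> and symmetry leave C_ji^3 = 0, so both sides vanish.\<close>
  show "adj_mat A $$ (i, i) * adj_mat A $$ (j, j) = adj_mat A $$ (i, j) * adj_mat A $$ (j, i)"
    using cc[OF i j] ccd[OF i j] eq
    unfolding C_def[symmetric] by (cases "C $$ (j, j) = 0") (auto simp: mult.commute)
qed

lemma adj_mat_plus_transpose:
  fixes A :: "'a::comm_ring_1 mat"
  assumes A: "A \<in> carrier_mat n n" and w: "w \<in> carrier_vec n"
    and eq: "A + A\<^sup>T = \<alpha> \<cdot>\<^sub>m (mat_of_cols n [w] * (mat_of_cols n [w])\<^sup>T)"
    and i: "i < n" and j: "j < n"
  defines "v \<equiv> adj_mat A *\<^sub>v w"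
  shows "det A * (adj_mat A $$ (i, j) + adj_mat A $$ (j, i)) = \<alpha> * (v $ i * v $ j)"
proof -
  define C where "C = adj_mat A"
  define W where "W = mat_of_cols n [w]"
  have C: "C \<in> carrier_mat n n" unfolding C_def by (rule adj_mat(1)[OF A])
  have W: "W \<in> carrier_mat n 1" unfolding W_def using mat_of_cols_carrier(1)[of n "[w]"] by simp
  \<comment> \<open>Both summands contain C A = det A I, the second one transposed.\<close>
  have "C * (A + A\<^sup>T) * C\<^sup>T = C * A * C\<^sup>T + C * (C * A)\<^sup>T"
    using A C by (simp add: mult_add_distrib_mat[of _ n n] add_mult_distrib_mat[of _ n n]
        transpose_mult[of _ n n])
  also have "\<dots> = det A \<cdot>\<^sub>m (C\<^sup>T + C)"
    using adj_mat(3)[OF A, folded C_def] C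
    by (auto intro!: eq_matI simp: distrib_left mult_smult_distrib[of _ n n] mult_smult_assoc_mat[of _ n n])
  finally have L: "C * (A + A\<^sup>T) * C\<^sup>T = det A \<cdot>\<^sub>m (C\<^sup>T + C)" .
  have "C * (\<alpha> \<cdot>\<^sub>m (W * W\<^sup>T)) * C\<^sup>T = \<alpha> \<cdot>\<^sub>m (C * (W * W\<^sup>T) * C\<^sup>T)"
    using C W by (simp add: mult_smult_distrib[of _ n n _ n] mult_smult_assoc_mat[of _ n n _ n])
  also have "C * (W * W\<^sup>T) * C\<^sup>T = (C * W) * W\<^sup>T * C\<^sup>T"
    using C W by (subst assoc_mult_mat[of C n n W 1 "W\<^sup>T" n]) auto
  also have "\<dots> = (C * W) * (C * W)\<^sup>T"
    unfolding transpose_mult[OF C W] using C W by (intro assoc_mult_mat[of _ n 1 _ n _ n]) auto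
  finally have "C * (\<alpha> \<cdot>\<^sub>m (W * W\<^sup>T)) * C\<^sup>T = \<alpha> \<cdot>\<^sub>m ((C * W) * (C * W)\<^sup>T)" .
  then have M: "det A \<cdot>\<^sub>m (C\<^sup>T + C) = \<alpha> \<cdot>\<^sub>m ((C * W) * (C * W)\<^sup>T)"
    using L eq by (simp add: W_def)
  have CW: "(C * W) $$ (k, 0) = v $ k" if "k < n" for k
    using C W w that by (simp add: v_def C_def[symmetric] W_def)
  have "((C * W) * (C * W)\<^sup>T) $$ (i, j) = v $ i * v $ j"
    using C W i j CW[OF i] CW[OF j] by (simp add: scalar_prod_def)
  moreover have "(det A \<cdot>\<^sub>m (C\<^sup>T + C)) $$ (i, j) = \<alpha> * ((C * W) * (C * W)\<^sup>T) $$ (i, j)"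
    unfolding M using C W i j by simp
  ultimately show ?thesis
    using C i j by (simp add: C_def[symmetric] add.commute)
qed

text \<open>The theorem in terms of the adjugate, for any pair of indices; the corner indices are
  the case of interest. The factor 4 clears the halves.\<close>

lemma adj_mat_principal_entries:
  fixes A :: "'a::field mat"
  assumes A: "A \<in> carrier_mat n n" and w: "w \<in> carrier_vec n"
    and eq: "A + A\<^sup>T = \<alpha> \<cdot>\<^sub>m (mat_of_cols n [w] * (mat_of_cols n [w])\<^sup>T)"
    and i: "i < n" and j: "j < n"
  shows "4 * (adj_mat A $$ (i, i) * adj_mat A $$ (j, j))
    = (adj_mat A $$ (i, j) + adj_mat A $$ (j, i))\<^sup>2"
proof (cases "det A = 0")
  case True
  note sing = adj_mat_entries_singular[OF A w _ True i j, of \<alpha>,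
      OF mat_plus_transpose_rank_one_entries[OF A w eq], simplified]
  show ?thesis
    using sing by (simp add: power2_eq_square)
next
  case False
  define v where "v = adj_mat A *\<^sub>v w"
  note inv = adj_mat_plus_transpose[OF A w eq, folded v_def]
  \<comment> \<open>One factor det A goes to each doubled diagonal entry, giving \<alpha> v_i^2 and
    \<alpha> v_j^2, whose product is the square of \<alpha> v_i v_j.\<close>
  have "(det A)\<^sup>2 * (4 * (adj_mat A $$ (i, i) * adj_mat A $$ (j, j)))
    = (det A * (adj_mat A $$ (i, i) + adj_mat A $$ (i, i)))
      * (det A * (adj_mat A $$ (j, j) + adj_mat A $$ (j, j)))"
    by (simp add: power2_eq_square algebra_simps)
  also have "\<dots> = (det A * (adj_mat A $$ (i, j) + adj_mat A $$ (j, i)))\<^sup>2"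
    unfolding inv[OF i i] inv[OF j j] inv[OF i j] by (simp add: power2_eq_square)
  also have "\<dots> = (det A)\<^sup>2 * (adj_mat A $$ (i, j) + adj_mat A $$ (j, i))\<^sup>2"
    by (rule power_mult_distrib)
  finally show ?thesis
    using False by simp
qed

text \<open>A block of n - 1 consecutive rows or columns omits the last one (index n - 1 from zero)
  if it starts at 1, and the first one (index 0) if it starts at 2.\<close>

lemma contig_submat_mat_delete:
  assumes A: "A \<in> carrier_mat n n" and n: "n \<ge> 2"
    and ij: "(i = 1 \<and> p = n - 1) \<or> (i = 2 \<and> p = 0)" "(j = 1 \<and> q = n - 1) \<or> (j = 2 \<and> q = 0)"
  shows "contig_submat A (n - 1) i j = mat_delete A p q"
proof -
  have "contig_submat A (n - 1) i j
    = mat (n - 1) (n - 1) (\<lambda>(p, q). A $$ (i - 1 + p, j - 1 + q))"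
    by (rule contig_submat_eq[OF A]) (use n ij in auto)
  also have "\<dots> = mat_delete A p q"
    by (rule eq_matI) (use A n ij in \<open>auto simp: mat_delete_def\<close>)
  finally show ?thesis .
qed

theorem theorem1p4:
  fixes n :: nat and A :: "real mat" and w :: "real vec" and \<alpha> :: real
  assumes "n \<ge> 2"
    and "A \<in> carrier_mat n n"
    and "w \<in> carrier_vec n" and "w \<noteq> 0\<^sub>v n"
    and "A + A\<^sup>T = \<alpha> \<cdot>\<^sub>m (mat_of_cols n [w] * (mat_of_cols n [w])\<^sup>T)"
  shows "det (contig_submat A (n - 1) 1 1) * det (contig_submat A (n - 1) 2 2) \<ge> 0 \<and>
    sqrt (det (contig_submat A (n - 1) 1 1) * det (contig_submat A (n - 1) 2 2)) =
      \<bar>(det (contig_submat A (n - 1) 1 2) + det (contig_submat A (n - 1) 2 1)) / 2\<bar>"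
proof -
  define M where "M i j = det (contig_submat A (n - 1) i j)" for i j
  \<comment> \<open>The sign of the two off-diagonal corner cofactors; the diagonal ones have sign
    +1. It disappears on squaring.\<close>
  define s :: real where "s = (- 1) ^ (n - 1)"
  have s2: "s\<^sup>2 = 1" unfolding s_def by (simp add: power_mult[symmetric] mult.commute)
  note del = contig_submat_mat_delete[OF assms(2,1)]
  \<comment> \<open>The adjugate transposes the cofactors: its entry (0, n - 1) deletes row n - 1
    and column 0, which leaves the block starting at (1, 2).\<close>
  have entries: "adj_mat A $$ (0, 0) = M 2 2" "adj_mat A $$ (n - 1, n - 1) = M 1 1"
    "adj_mat A $$ (0, n - 1) = s * M 1 2" "adj_mat A $$ (n - 1, 0) = s * M 2 1"
    using assms(1,2) del[of 1 "n - 1" 1 "n - 1"] del[of 1 "n - 1" 2 0] del[of 2 0 1 "n - 1"]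
      del[of 2 0 2 0]
    by (simp_all add: adj_mat_def cofactor_def M_def s_def)
  have "4 * (adj_mat A $$ (0, 0) * adj_mat A $$ (n - 1, n - 1))
    = (adj_mat A $$ (0, n - 1) + adj_mat A $$ (n - 1, 0))\<^sup>2"
    by (rule adj_mat_principal_entries[OF assms(2,3,5)]) (use assms(1) in auto)
  also have "\<dots> = s\<^sup>2 * (M 1 2 + M 2 1)\<^sup>2"
    unfolding entries by (simp add: power_mult_distrib[symmetric] distrib_left)
  finally have key: "M 1 1 * M 2 2 = ((M 1 2 + M 2 1) / 2)\<^sup>2"
    unfolding entries s2 by (simp add: power_divide mult.commute)
  \<comment> \<open>Since \<open>key\<close> exhibits the product as a square, it is nonnegative and
    its root is an absolute value.\<close>
  show ?thesis
    unfolding M_def[symmetric] key by (simp del: abs_divide)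
qed

end
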